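(* Let $0\le\alpha\le 3-2\sqrt{2}$ and let $f(z)=z+\sum_{n=2}^\infty a_nz^n$ belong to the class $\mathcal{BS}(\alpha)$. Then $|a_2|\le 1$ and $$|a_n|\le\frac{1}{n-1}\prod_{k=2}^{n-1}\left(\frac{k}{k-1}\right)\qquad(n=3,4,\ldots).$$
   Context: $\Delta=\{z\in\mathbb{C}:|z|<1\}$. $\mathcal{A}$ is the class of functions $f$ analytic in $\Delta$ of the form $f(z)=z+\sum_{n\ge2}a_nz^n$. For $g,h$ analytic in $\Delta$, $g\prec h$ (subordination) means there is an analytic $w:\Delta\to\Delta$ with $w(0)=0$ and $g(z)=h(w(z))$ for all $z\in\Delta$. For $0\le\alpha<1$ let $F_\alpha(z)=\frac{z}{1-\alpha z^2}$. The class $\mathcal{BS}(\alpha)$ consists of all $f\in\mathcal{A}$ such that $\frac{zf'(z)}{f(z)}-1\prec F_\alpha(z)$ in $\Delta$ (in particular $zf'(z)/f(z)$ is analytic in $\Delta$). *)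

theory Defs
  imports "HOL-Complex_Analysis.Complex_Analysis"
begin

abbreviation unit_disc :: "complex set" where
  "unit_disc \<equiv> ball 0 1"

text \<open>\<open>f(z) = z + (\<Sum>n\<ge>2. a n * z^n)\<close> on the unit disc; the values \<open>a 0\<close> and \<open>a 1\<close> play no role.\<close>
definition normalized_expansion :: "(complex \<Rightarrow> complex) \<Rightarrow> (nat \<Rightarrow> complex) \<Rightarrow> bool" where
  "normalized_expansion f a \<longleftrightarrow>
     (\<forall>z\<in>unit_disc. (\<lambda>n. a (n + 2) * z ^ (n + 2)) sums (f z - z))"

definition class_A :: "(complex \<Rightarrow> complex) set" where
  "class_A = {f. f analytic_on unit_disc \<and> (\<exists>a. normalized_expansion f a)}"

definition subordinate :: "(complex \<Rightarrow> complex) \<Rightarrow> (complex \<Rightarrow> complex) \<Rightarrow> bool" where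
  "subordinate g h \<longleftrightarrow>
     g analytic_on unit_disc \<and> h analytic_on unit_disc \<and>
     (\<exists>w. w analytic_on unit_disc \<and> w ` unit_disc \<subseteq> unit_disc \<and> w 0 = 0 \<and>
          (\<forall>z\<in>unit_disc. g z = h (w z)))"

definition F :: "real \<Rightarrow> complex \<Rightarrow> complex" where
  "F \<alpha> z = z / (1 - of_real \<alpha> * z ^ 2)"

text \<open>\<open>z f'(z) / f(z)\<close>, with the removable singularity at \<open>0\<close> filled in: for \<open>f\<close> in
  \<open>class_A\<close> the limit there is \<open>1\<close>, whereas division by zero would give \<open>0\<close>.\<close>
definition zderiv_quotient :: "(complex \<Rightarrow> complex) \<Rightarrow> complex \<Rightarrow> complex" where
  "zderiv_quotient f z = (if z = 0 then 1 else z * deriv f z / f z)"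

text \<open>The condition \<open>f z \<noteq> 0\<close> makes explicit that the quotient is a genuine analytic function
  on the disc (a zero of \<open>f\<close> off the origin would be a pole of it).\<close>
definition BS :: "real \<Rightarrow> (complex \<Rightarrow> complex) set" where
  "BS \<alpha> = {f. f \<in> class_A \<and> (\<forall>z\<in>unit_disc - {0}. f z \<noteq> 0) \<and>
              subordinate (\<lambda>z. zderiv_quotient f z - 1) (F \<alpha>)}"

end

(*
  Since 1/F_alpha(w) = 1/w - alpha w, the reciprocal of the boundary curve of F_alpha is an ellipse.
  Hence the image of the disc is {N < 1} for the positively homogeneous function N below.
  Exactly for alpha <= 3 - 2 sqrt 2 (i.e. (1 + alpha)/(1 - alpha) <= sqrt 2) N has a supporting
  functional in every direction, so the image is closed under means.  Rogosinski's argument then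
  bounds the coefficients of p = z f'/f - 1 by 1: averaging p over rotations by n-th roots of
  unity kills the coefficients below n, and the inverse of F_alpha maps the mean into the disc, so
  the maximum principle applies.  Finally (n - 1) a_n is the sum of a_k p_(n-k), 1 <= k < n, whence
  |a_n| <= 1 by induction, while the product in the claim telescopes to n - 1.
*)
theory Submission imports Defs begin

section \<open>The gauge of the image of \<open>F \<alpha>\<close> and its convexity\<close>

text \<open>Level 1 is the ellipse traced by \<open>1 / w - \<alpha> * w\<close> for
  \<open>norm w = 1\<close>, with semi-axes \<open>1 - \<alpha>\<close> and
  \<open>1 + \<alpha>\<close>.\<close>

definition F_gauge_form :: "real \<Rightarrow> complex \<Rightarrow> real" where
  "F_gauge_form \<alpha> v = (Re v / (1 - \<alpha>))\<^sup>2 + (Im v / (1 + \<alpha>))\<^sup>2"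

text \<open>At \<open>v = 0\<close> the quotient below is \<open>0 / 0 = 0\<close>, as it should be.\<close>
definition F_gauge :: "real \<Rightarrow> complex \<Rightarrow> real" where
  "F_gauge \<alpha> v = (norm v)\<^sup>2 / sqrt (F_gauge_form \<alpha> v)"

lemma gauge_nonneg: "0 \<le> F_gauge \<alpha> v"
  by (simp add: F_gauge_def F_gauge_form_def)

text \<open>Supporting functional at \<open>(c, s)\<close> for the homogeneous function
  \<open>(X\<^sup>2 + 2 * Y\<^sup>2) / sqrt (X\<^sup>2 + Y\<^sup>2)\<close>, whose gradient there is \<open>(c^3, 3 * s - s^3)\<close>.\<close>
lemma support_unit_circle:
  fixes c s p q :: real
  assumes cs: "c\<^sup>2 + s\<^sup>2 = 1" and pq: "p\<^sup>2 + q\<^sup>2 = 1"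
  shows "c^3 * p + (3 * s - s^3) * q \<le> 1 + q\<^sup>2"
proof -
  have "s\<^sup>2 \<le> 1" using cs by (metis le_add_same_cancel2 zero_le_power2)
  \<comment> \<open>Twice the gap is a weighted sum of squares that vanishes at
    \<open>(p, q) = (c, s)\<close>.\<close>
  hence "0 \<le> c\<^sup>2 * (c - p)\<^sup>2 + (3 - s\<^sup>2) * (q - s)\<^sup>2" by simp
  also have "\<dots> = 2 * (1 + q\<^sup>2 - (c^3 * p + (3 * s - s^3) * q))"
    using cs pq by algebra
  finally show ?thesis by simp
qed

text \<open>The number \<open>3 - 2 * sqrt 2\<close> is \<open>(sqrt 2 - 1) / (sqrt 2 + 1)\<close>,
  the \<alpha> at which \<open>(1 + \<alpha>) / (1 - \<alpha>)\<close> equals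
  \<open>sqrt 2\<close>.\<close>

lemma alpha_bounds:
  fixes \<alpha> :: real
  assumes "0 \<le> \<alpha>" "\<alpha> \<le> 3 - 2 * sqrt 2"
  shows "\<alpha> < 1" "(1 + \<alpha>)\<^sup>2 \<le> 2 * (1 - \<alpha>)\<^sup>2"
proof -
  have s: "1 < sqrt 2" "sqrt 2 * sqrt 2 = (2::real)" by auto
  show a: "\<alpha> < 1" using s assms by linarith
  have "(1 + sqrt 2) * \<alpha> \<le> (1 + sqrt 2) * (3 - 2 * sqrt 2)"
    using assms s by (intro mult_left_mono) auto
  also have "\<dots> = sqrt 2 - 1" using s(2) by (simp add: algebra_simps)
  finally have "1 + \<alpha> \<le> sqrt 2 * (1 - \<alpha>)" by (simp add: algebra_simps)
  hence "(1 + \<alpha>)\<^sup>2 \<le> (sqrt 2 * (1 - \<alpha>))\<^sup>2" using assms by (intro power_mono) auto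
  thus "(1 + \<alpha>)\<^sup>2 \<le> 2 * (1 - \<alpha>)\<^sup>2" by (simp add: power_mult_distrib)
qed

text \<open>After rescaling the axes by \<open>A\<close> and \<open>B\<close>, the gauge is
  \<open>A^2 - \<delta>\<close> times the Euclidean norm plus \<delta> times the function of
  \<open>support_unit_circle\<close>. Both weights are nonnegative because
  \<open>B^2 \<le> 2 * A^2\<close>, so the supporting functionals of the two parts add up.\<close>

lemma gauge_support:
  fixes \<alpha> :: real and u :: complex
  assumes "0 \<le> \<alpha>" "\<alpha> \<le> 3 - 2 * sqrt 2"
  obtains d where "d \<bullet> u = F_gauge \<alpha> u" "\<And>v. d \<bullet> v \<le> F_gauge \<alpha> v"
proof (cases "u = 0")
  case True
  thus ?thesis by (intro that[of 0]) (auto simp: gauge_nonneg F_gauge_def[of _ 0])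
next
  case False
  define A B where "A = 1 - \<alpha>" and "B = 1 + \<alpha>"
  have AB: "0 < A" "0 < B" "A\<^sup>2 \<le> B\<^sup>2" "B\<^sup>2 \<le> 2 * A\<^sup>2"
    using alpha_bounds[OF assms] assms by (auto simp: A_def B_def)
  define \<rho> where "\<rho> v = sqrt (F_gauge_form \<alpha> v)" for v
  define X Y where "X v = Re v / A / \<rho> v" and "Y v = Im v / B / \<rho> v" for v :: complex
  have \<rho>pos: "\<rho> v > 0" if "v \<noteq> 0" for v
    using that AB by (auto simp: \<rho>_def F_gauge_form_def A_def B_def complex_eq_iff add_pos_nonneg add_nonneg_pos)
  have \<rho>2: "(\<rho> v)\<^sup>2 = (Re v / A)\<^sup>2 + (Im v / B)\<^sup>2" for v
    by (simp add: \<rho>_def F_gauge_form_def A_def B_def)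
  have unit: "(X v)\<^sup>2 + (Y v)\<^sup>2 = 1" if "v \<noteq> 0" for v
  proof -
    have "(X v)\<^sup>2 + (Y v)\<^sup>2 = ((Re v / A)\<^sup>2 + (Im v / B)\<^sup>2) / (\<rho> v)\<^sup>2"
      unfolding X_def Y_def power_divide[of _ "\<rho> v"] by (simp only: add_divide_distrib)
    thus ?thesis using \<rho>pos[OF that] by (simp flip: \<rho>2)
  qed
  have Re_eq: "Re v = A * \<rho> v * X v" and Im_eq: "Im v = B * \<rho> v * Y v" if "v \<noteq> 0" for v
    using \<rho>pos[OF that] AB by (auto simp: X_def Y_def)
  \<comment> \<open>Split off the extreme case \<open>B\<^sup>2 = 2 * A\<^sup>2\<close>; both parts of the decomposition in \<open>gauge_eq\<close> are convex.\<close>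
  define \<delta> where "\<delta> = B\<^sup>2 - A\<^sup>2"
  have \<delta>: "0 \<le> \<delta>" "\<delta> \<le> A\<^sup>2" using AB by (auto simp: \<delta>_def)
  have gauge_eq: "F_gauge \<alpha> v = \<rho> v * ((A\<^sup>2 - \<delta>) + \<delta> * (1 + (Y v)\<^sup>2))" if "v \<noteq> 0" for v
  proof -
    have "(norm v)\<^sup>2 = (\<rho> v)\<^sup>2 * (A\<^sup>2 * (X v)\<^sup>2 + B\<^sup>2 * (Y v)\<^sup>2)"
      unfolding cmod_power2 by (subst Re_eq[OF that], subst Im_eq[OF that]) (simp add: algebra_simps power_mult_distrib)
    also have "(X v)\<^sup>2 = 1 - (Y v)\<^sup>2" using unit[OF that] by simp
    finally have "(norm v)\<^sup>2 = (\<rho> v)\<^sup>2 * ((A\<^sup>2 - \<delta>) + \<delta> * (1 + (Y v)\<^sup>2))"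
      by (simp add: \<delta>_def algebra_simps)
    thus ?thesis using \<rho>pos[OF that] unfolding F_gauge_def \<rho>_def[symmetric]
      by (simp add: power2_eq_square)
  qed
  define c s where "c = X u" and "s = Y u"
  have cs: "c\<^sup>2 + s\<^sup>2 = 1" using unit[OF False] by (simp add: c_def s_def)
  \<comment> \<open>The gradient of the gauge at \<open>u\<close>: \<open>(c, s)\<close> comes from
    the Euclidean norm, the cubic terms from the extreme case, and the divisions by \<open>A\<close>
    and \<open>B\<close> undo the rescaling.\<close>
  define d where "d = Complex (((A\<^sup>2 - \<delta>) * c + \<delta> * c^3) / A) (((A\<^sup>2 - \<delta>) * s + \<delta> * (3 * s - s^3)) / B)"
  have inner_d: "d \<bullet> v = \<rho> v * ((A\<^sup>2 - \<delta>) * (c * X v + s * Y v) + \<delta> * (c^3 * X v + (3 * s - s^3) * Y v))"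
    if "v \<noteq> 0" for v
  proof -
    have "d \<bullet> v = ((A\<^sup>2 - \<delta>) * c + \<delta> * c^3) / A * Re v + ((A\<^sup>2 - \<delta>) * s + \<delta> * (3 * s - s^3)) / B * Im v"
      by (simp add: d_def inner_complex_def)
    also have "\<dots> = ((A\<^sup>2 - \<delta>) * c + \<delta> * c^3) * (\<rho> v * X v) + ((A\<^sup>2 - \<delta>) * s + \<delta> * (3 * s - s^3)) * (\<rho> v * Y v)"
      using AB by (simp add: Re_eq[OF that] Im_eq[OF that])
    finally show ?thesis by (simp add: algebra_simps)
  qed
  show ?thesis
  proof (rule that)
    have "c * c + s * s = 1" "c^3 * c + (3 * s - s^3) * s = 1 + s\<^sup>2"
      using cs by (simp add: power2_eq_square, algebra)
    thus "d \<bullet> u = F_gauge \<alpha> u"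
      unfolding inner_d[OF False] gauge_eq[OF False] c_def[symmetric] s_def[symmetric] by simp
  next
    fix v
    show "d \<bullet> v \<le> F_gauge \<alpha> v"
    proof (cases "v = 0")
      case False
      have "0 \<le> (c - X v)\<^sup>2 + (s - Y v)\<^sup>2" by simp
      hence "c * X v + s * Y v \<le> 1"
        using cs unit[OF False] by (simp add: power2_diff)
      moreover have "c^3 * X v + (3 * s - s^3) * Y v \<le> 1 + (Y v)\<^sup>2"
        by (rule support_unit_circle[OF cs unit[OF False]])
      ultimately have "(A\<^sup>2 - \<delta>) * (c * X v + s * Y v) + \<delta> * (c^3 * X v + (3 * s - s^3) * Y v)
          \<le> (A\<^sup>2 - \<delta>) * 1 + \<delta> * (1 + (Y v)\<^sup>2)"
        using \<delta> by (intro add_mono[of "_ * _" "_ * _" "_ * _" "_ * _"] mult_left_mono) auto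
      thus ?thesis unfolding inner_d[OF False] gauge_eq[OF False]
        using \<rho>pos[OF False] by (intro mult_left_mono) auto
    qed (simp add: gauge_nonneg)
  qed
qed

text \<open>The functional that attains the gauge at the mean is linear, so the gauge of the mean is
  the mean of its values at the points, each below 1.\<close>

lemma gauge_mean_less_one:
  fixes \<alpha> :: real and v :: "'i \<Rightarrow> complex"
  assumes "0 \<le> \<alpha>" "\<alpha> \<le> 3 - 2 * sqrt 2"
    and "finite I" "I \<noteq> {}" "\<And>i. i \<in> I \<Longrightarrow> F_gauge \<alpha> (v i) < 1"
  shows "F_gauge \<alpha> ((\<Sum>i\<in>I. v i) / of_nat (card I)) < 1"
proof -
  define m where "m = (\<Sum>i\<in>I. v i) / of_nat (card I)"
  have n: "card I > 0" using assms by (simp add: card_gt_0_iff)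
  obtain d where d: "d \<bullet> m = F_gauge \<alpha> m" "\<And>v. d \<bullet> v \<le> F_gauge \<alpha> v"
    using gauge_support[OF assms(1,2)] by blast
  have "real (card I) *\<^sub>R m = (\<Sum>i\<in>I. v i)"
    using n by (simp add: m_def scaleR_conv_of_real)
  hence "real (card I) * F_gauge \<alpha> m = (\<Sum>i\<in>I. d \<bullet> v i)"
    by (metis d(1) inner_scaleR_right inner_sum_right)
  also have "\<dots> < (\<Sum>i\<in>I. 1)"
    using assms d(2) by (intro sum_strict_mono) (auto intro: le_less_trans)
  finally show ?thesis using n by (simp add: m_def)
qed

section \<open>The image of the disc as a sublevel set of the gauge\<close>

text \<open>Inversion divides the quadratic form by \<open>(norm v)^4\<close>, so the gauge of
  \<open>v\<close> is the reciprocal root of the form at \<open>inverse v\<close>.\<close>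

lemma gauge_less_one_iff:
  fixes \<alpha> :: real
  assumes "0 \<le> \<alpha>" "\<alpha> < 1" "v \<noteq> 0"
  shows "F_gauge \<alpha> v < 1 \<longleftrightarrow> 1 < F_gauge_form \<alpha> (inverse v)"
proof -
  have pos: "F_gauge_form \<alpha> v > 0"
    using assms by (auto simp: F_gauge_form_def complex_eq_iff add_pos_nonneg add_nonneg_pos)
  have "F_gauge_form \<alpha> (inverse v) = F_gauge_form \<alpha> v / (norm v)^4"
  proof -
    have "Re (inverse v) = Re v / (norm v)\<^sup>2" "Im (inverse v) = - (Im v / (norm v)\<^sup>2)"
      by (simp_all add: cmod_power2)
    hence "F_gauge_form \<alpha> (inverse v) = (Re v / (1 - \<alpha>) / (norm v)\<^sup>2)\<^sup>2 + (Im v / (1 + \<alpha>) / (norm v)\<^sup>2)\<^sup>2"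
      by (simp only: F_gauge_form_def power2_minus minus_divide_left[symmetric] divide_divide_eq_left mult.commute)
    also have "\<dots> = F_gauge_form \<alpha> v / ((norm v)\<^sup>2)\<^sup>2"
      unfolding F_gauge_form_def power_divide[of _ "(norm v)\<^sup>2"] by (simp only: add_divide_distrib)
    finally show ?thesis by simp
  qed
  moreover have "F_gauge \<alpha> v < 1 \<longleftrightarrow> (norm v)\<^sup>2 < sqrt (F_gauge_form \<alpha> v)"
    using pos by (simp add: F_gauge_def)
  moreover have "\<dots> \<longleftrightarrow> ((norm v)\<^sup>2)\<^sup>2 < F_gauge_form \<alpha> v"
    using pos by (metis abs_of_nonneg real_sqrt_abs real_sqrt_less_iff zero_le_power2)
  ultimately show ?thesis using assms(3) by simp
qed

text \<open>The circle of radius \<open>r\<close> goes under \<open>inverse (F \<alpha> w)\<close>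
  to an ellipse with semi-axes \<open>1 / r - \<alpha> * r\<close> and
  \<open>1 / r + \<alpha> * r\<close>. Both exceed those for \<open>r = 1\<close> when
  \<open>r < 1\<close>, and neither does when \<open>r \<ge> 1\<close>.\<close>

lemma gauge_F_less_one_iff:
  fixes \<alpha> :: real
  assumes "0 \<le> \<alpha>" "\<alpha> < 1" and aw: "\<alpha> * (norm w)\<^sup>2 < 1"
  shows "F_gauge \<alpha> (F \<alpha> w) < 1 \<longleftrightarrow> norm w < 1"
proof (cases "w = 0")
  case True
  thus ?thesis by (simp add: F_def F_gauge_def)
next
  case False
  define r where "r = norm w"
  have r: "r > 0" using False by (simp add: r_def)
  have "norm (of_real \<alpha> * w\<^sup>2) < 1" using aw assms(1) by (simp add: norm_mult norm_power)
  hence nz: "1 - of_real \<alpha> * w\<^sup>2 \<noteq> 0" by auto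
  hence Fnz: "F \<alpha> w \<noteq> 0" using False by (simp add: F_def)
  have inv: "inverse (F \<alpha> w) = inverse w - of_real \<alpha> * w"
    using False nz by (simp add: F_def field_simps power2_eq_square)
  define x y where "x = Re w / r" and "y = Im w / r"
  have xy: "x\<^sup>2 + y\<^sup>2 = 1"
  proof -
    have "x\<^sup>2 + y\<^sup>2 = ((Re w)\<^sup>2 + (Im w)\<^sup>2) / r\<^sup>2"
      by (simp add: x_def y_def power_divide add_divide_distrib)
    also have "\<dots> = 1" using r by (simp add: r_def flip: cmod_power2)
    finally show ?thesis .
  qed
  \<comment> \<open>The semi-axes relative to those for \<open>r = 1\<close>.\<close>
  define a b where "a = (1 / r - \<alpha> * r) / (1 - \<alpha>)" and "b = (1 / r + \<alpha> * r) / (1 + \<alpha>)"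
  have r2: "(Re w)\<^sup>2 + (Im w)\<^sup>2 = r\<^sup>2" by (simp add: r_def cmod_power2)
  have "Re (inverse (F \<alpha> w)) = Re w / r\<^sup>2 - \<alpha> * Re w"
    "Im (inverse (F \<alpha> w)) = - (Im w / r\<^sup>2 + \<alpha> * Im w)"
    by (simp_all add: inv r2)
  moreover have "Re w = r * x" "Im w = r * y" using r by (simp_all add: x_def y_def)
  ultimately have "Re (inverse (F \<alpha> w)) = x * (1 / r - \<alpha> * r)"
    "Im (inverse (F \<alpha> w)) = - (y * (1 / r + \<alpha> * r))"
    using r by (simp_all add: power2_eq_square algebra_simps)
  hence form: "F_gauge_form \<alpha> (inverse (F \<alpha> w)) = x\<^sup>2 * a\<^sup>2 + y\<^sup>2 * b\<^sup>2"
    by (simp add: F_gauge_form_def a_def b_def power_divide power_mult_distrib)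
  have ar: "\<alpha> * r * r < 1" using aw by (simp add: r_def power2_eq_square mult.assoc)
  have d1: "1 / r - \<alpha> * r - (1 - \<alpha>) = (1 - r) * (1 / r + \<alpha>)"
    and d2: "1 / r + \<alpha> * r - (1 + \<alpha>) = (1 - r) * (1 / r - \<alpha>)"
    using r by (simp_all add: field_simps)
  show ?thesis
  proof (cases "r < 1")
    case True
    have "1 / r > 1" using True r by simp
    hence "\<alpha> < 1 / r" using assms(2) by linarith
    hence "0 < (1 - r) * (1 / r + \<alpha>)" "0 < (1 - r) * (1 / r - \<alpha>)"
      using True r assms by (auto intro!: mult_pos_pos add_pos_nonneg)
    hence "1 < a" "1 < b" using d1 d2 assms by (auto simp: a_def b_def)
    hence "1 < a\<^sup>2" "1 < b\<^sup>2" by (auto intro: one_less_power)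
    hence "1 < min (a\<^sup>2) (b\<^sup>2)" by simp
    also have "\<dots> = x\<^sup>2 * min (a\<^sup>2) (b\<^sup>2) + y\<^sup>2 * min (a\<^sup>2) (b\<^sup>2)"
      using xy by (simp flip: distrib_right)
    also have "\<dots> \<le> x\<^sup>2 * a\<^sup>2 + y\<^sup>2 * b\<^sup>2"
      by (intro add_mono mult_left_mono) auto
    finally have "1 < F_gauge_form \<alpha> (inverse (F \<alpha> w))" using form by simp
    thus ?thesis using True gauge_less_one_iff[OF assms(1,2) Fnz] by (simp add: r_def)
  next
    case False
    hence r1: "r \<ge> 1" by simp
    \<comment> \<open>Here \<open>aw\<close> enters: it also keeps \<open>a\<close> nonnegative, so
      that \<open>a \<le> 1\<close> survives squaring.\<close>
    have ar1: "\<alpha> * r < 1 / r" using ar r by (simp add: field_simps)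
    moreover have "\<alpha> * 1 \<le> \<alpha> * r" using r1 assms by (intro mult_left_mono) auto
    ultimately have "\<alpha> < 1 / r" by simp
    hence "(1 - r) * (1 / r + \<alpha>) \<le> 0" "(1 - r) * (1 / r - \<alpha>) \<le> 0"
      using r1 assms by (auto intro!: mult_nonpos_nonneg)
    hence "a \<le> 1" "b \<le> 1" using d1 d2 assms by (auto simp: a_def b_def)
    moreover have "0 \<le> a" "0 \<le> b" using ar1 r assms by (auto simp: a_def b_def)
    ultimately have "a\<^sup>2 \<le> 1" "b\<^sup>2 \<le> 1" by (auto simp: power_le_one)
    hence "x\<^sup>2 * a\<^sup>2 + y\<^sup>2 * b\<^sup>2 \<le> x\<^sup>2 * 1 + y\<^sup>2 * 1" by (intro add_mono mult_left_mono) auto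
    hence "F_gauge_form \<alpha> (inverse (F \<alpha> w)) \<le> 1" using xy form by simp
    thus ?thesis using False gauge_less_one_iff[OF assms(1,2) Fnz] by (simp add: r_def)
  qed
qed

section \<open>The inverse of \<open>F \<alpha>\<close> on the image\<close>

text \<open>This is the discriminant of \<open>\<alpha> * v * w^2 + w - v = 0\<close>, the equation
  \<open>F \<alpha> w = v\<close>. It meets the cut only for imaginary \<open>v\<close> with
  \<open>4 * \<alpha> * (Im v)^2 \<ge> 1\<close>, where the gauge
  \<open>\<bar>Im v\<bar> * (1 + \<alpha>)\<close> is at least 1 by
  \<open>(1 + \<alpha>)^2 \<ge> 4 * \<alpha>\<close>.\<close>

lemma gauge_less_one_avoids_branch_cut:
  fixes \<alpha> :: real
  assumes "0 \<le> \<alpha>" "\<alpha> < 1" "F_gauge \<alpha> v < 1"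
  shows "1 + 4 * of_real \<alpha> * v\<^sup>2 \<notin> \<real>\<^sub>\<le>\<^sub>0"
proof
  assume "1 + 4 * of_real \<alpha> * v\<^sup>2 \<in> \<real>\<^sub>\<le>\<^sub>0"
  hence re: "1 + 4 * \<alpha> * ((Re v)\<^sup>2 - (Im v)\<^sup>2) \<le> 0" and im: "\<alpha> * Re v * Im v = 0"
    by (auto simp: complex_nonpos_Reals_iff power2_eq_square algebra_simps)
  have \<alpha>: "\<alpha> > 0" using re assms(1) by (cases "\<alpha> = 0") auto
  have "Im v \<noteq> 0"
  proof
    assume "Im v = 0"
    moreover have "0 \<le> 4 * \<alpha> * (Re v)\<^sup>2" using \<alpha> by simp
    ultimately show False using re by simp
  qed
  hence Re: "Re v = 0" using im \<alpha> by simp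
  hence re': "1 \<le> 4 * \<alpha> * (Im v)\<^sup>2" using re by simp
  have "sqrt (F_gauge_form \<alpha> v) = \<bar>Im v\<bar> / (1 + \<alpha>)"
    using assms Re by (simp add: F_gauge_form_def)
  hence "F_gauge \<alpha> v = \<bar>Im v\<bar>\<^sup>2 / (\<bar>Im v\<bar> / (1 + \<alpha>))"
    using Re by (simp add: F_gauge_def cmod_power2)
  also have "\<dots> = \<bar>Im v\<bar> * (1 + \<alpha>)"
    using \<open>Im v \<noteq> 0\<close> by (simp only: power2_eq_square) (simp add: field_simps)
  finally have "F_gauge \<alpha> v = \<bar>Im v\<bar> * (1 + \<alpha>)" .
  hence "(\<bar>Im v\<bar> * (1 + \<alpha>))\<^sup>2 < 1" using assms gauge_nonneg[of \<alpha> v] by (simp add: power_less_one_iff)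
  hence "(Im v)\<^sup>2 * (1 + \<alpha>)\<^sup>2 < 1" by (simp add: power_mult_distrib)
  moreover have "4 * \<alpha> \<le> (1 + \<alpha>)\<^sup>2" using zero_le_power2[of "1 - \<alpha>"] by (simp add: power2_eq_square algebra_simps)
  hence "(Im v)\<^sup>2 * (4 * \<alpha>) \<le> (Im v)\<^sup>2 * (1 + \<alpha>)\<^sup>2" by (intro mult_left_mono) auto
  ultimately show False using re' by (simp add: algebra_simps)
qed

text \<open>The root of the quadratic is written with the square root in the denominator, which also
  covers \<open>\<alpha> = 0\<close> and \<open>v = 0\<close>. For this root
  \<open>\<alpha> * w^2\<close> is the Cayley transform of \<open>S\<close>, of modulus below 1 as
  \<open>Re S > 0\<close>, so \<open>gauge_F_less_one_iff\<close> applies.\<close>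

lemma norm_F_inverse_less_one:
  fixes \<alpha> :: real
  assumes "0 \<le> \<alpha>" "\<alpha> < 1" "F_gauge \<alpha> v < 1"
  shows "norm (2 * v / (1 + csqrt (1 + 4 * of_real \<alpha> * v\<^sup>2))) < 1"
proof -
  define S where "S = csqrt (1 + 4 * of_real \<alpha> * v\<^sup>2)"
  have S2: "S\<^sup>2 = 1 + 4 * of_real \<alpha> * v\<^sup>2" by (simp add: S_def)
  have nn: "1 + 4 * of_real \<alpha> * v\<^sup>2 \<notin> \<real>\<^sub>\<le>\<^sub>0" by (rule gauge_less_one_avoids_branch_cut[OF assms])
  have ReS: "Re S > 0"
    using nn csqrt_principal[of "1 + 4 * of_real \<alpha> * v\<^sup>2"] unfolding S_def[symmetric]
  proof -
    assume "0 < Re S \<or> Re S = 0 \<and> 0 \<le> Im S"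
    moreover have "Re S \<noteq> 0"
    proof
      assume "Re S = 0"
      hence "S\<^sup>2 \<in> \<real>\<^sub>\<le>\<^sub>0" by (simp add: complex_nonpos_Reals_iff power2_eq_square)
      thus False using nn S2 by simp
    qed
    ultimately show ?thesis by simp
  qed
  hence nz: "1 + S \<noteq> 0" by (auto simp: complex_eq_iff)
  define w where "w = 2 * v / (1 + S)"
  have aw: "of_real \<alpha> * w\<^sup>2 = (S - 1) / (S + 1)"
  proof -
    have "of_real \<alpha> * w\<^sup>2 = (4 * of_real \<alpha> * v\<^sup>2) / (1 + S)\<^sup>2"
      by (simp add: w_def power_divide power_mult_distrib)
    also have "4 * of_real \<alpha> * v\<^sup>2 = (S - 1) * (1 + S)"
      using S2 by (simp add: algebra_simps power2_eq_square)
    finally show ?thesis using nz by (simp add: power2_eq_square add.commute)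
  qed
  have "(norm (S - 1))\<^sup>2 < (norm (S + 1))\<^sup>2"
    using ReS unfolding cmod_power2 by (simp add: power2_eq_square algebra_simps)
  hence "norm (S - 1) < norm (S + 1)" by (rule power_less_imp_less_base) simp
  hence "norm (of_real \<alpha> * w\<^sup>2) < 1" unfolding aw
    using nz by (simp add: norm_divide add.commute)
  hence "\<alpha> * (norm w)\<^sup>2 < 1" using assms by (simp add: norm_mult norm_power)
  moreover have "F \<alpha> w = v"
  proof -
    have "1 - of_real \<alpha> * w\<^sup>2 = 2 / (1 + S)"
      unfolding aw using nz by (simp add: field_simps)
    thus ?thesis using nz by (simp add: F_def w_def)
  qed
  ultimately show ?thesis
    using gauge_F_less_one_iff[OF assms(1,2), of w] assms(3) by (simp add: w_def S_def)
qed

section \<open>Rogosinski's coefficient bound\<close>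

text \<open>A Schwarz lemma of order \<open>n\<close>: the maximum principle on radius
  \<open>r\<close> gives \<open>1 / r ^ n\<close>, then \<open>r\<close> tends to 1.\<close>

lemma norm_at_zero_le_one:
  assumes hol: "K holomorphic_on ball 0 1"
    and bound: "\<And>z. norm z < 1 \<Longrightarrow> norm (z ^ n * K z) \<le> 1"
  shows "norm (K 0) \<le> 1"
proof -
  have le: "norm (K 0) \<le> 1 / r ^ n" if r: "0 < r" "r < 1" for r :: real
  proof (rule maximum_modulus_frontier[of K "ball 0 r"])
    show "K holomorphic_on interior (ball 0 r)"
      using hol r by (auto intro: holomorphic_on_subset)
    show "continuous_on (closure (ball 0 r)) K"
      using r by (auto intro!: holomorphic_on_imp_continuous_on holomorphic_on_subset[OF hol])
    show "bounded (ball 0 r :: complex set)" by simp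
    show "norm (K z) \<le> 1 / r ^ n" if "z \<in> frontier (ball 0 r)" for z
      using bound[of z] that r by (simp add: norm_mult norm_power field_simps)
    show "0 \<in> ball 0 r" using r by simp
  qed
  have "((\<lambda>r. 1 / r ^ n) \<longlongrightarrow> 1 / 1 ^ n) (at_left (1::real))"
    by (intro tendsto_intros) auto
  moreover have "\<forall>\<^sub>F r in at_left (1::real). norm (K 0) \<le> 1 / r ^ n"
    using eventually_at_left[of 0 "1::real"] le by (auto intro!: exI[of _ 0])
  ultimately show ?thesis using tendsto_lowerbound by fastforce
qed

lemma rogosinski_coeff_bound:
  fixes \<alpha> :: real and p :: "nat \<Rightarrow> complex"
  assumes \<alpha>: "0 \<le> \<alpha>" "\<alpha> \<le> 3 - 2 * sqrt 2"
    and sums: "\<And>z. norm z < 1 \<Longrightarrow> (\<lambda>m. p m * z ^ m) sums g z"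
    and gauge: "\<And>z. norm z < 1 \<Longrightarrow> F_gauge \<alpha> (g z) < 1"
    and p0: "p 0 = 0" and n: "n > 0"
  shows "norm (p n) \<le> 1"
proof -
  have \<alpha>1: "\<alpha> < 1" using alpha_bounds[OF \<alpha>] by simp
  define \<zeta> where "\<zeta> = exp (2 * of_real pi * \<i> / of_nat n)"
  have nz: "norm \<zeta> = 1" by (simp add: \<zeta>_def)
  have \<zeta>_eq_1: "\<zeta> ^ m = 1 \<longleftrightarrow> n dvd m" for m
  proof -
    have "\<zeta> ^ m = exp (2 * of_real pi * \<i> * of_nat m / of_nat n)"
      by (simp add: \<zeta>_def mult_ac flip: exp_of_nat_mult)
    thus ?thesis using complex_root_unity_eq_1[of n m] n by simp
  qed
  define P where "P z = (\<Sum>k<n. g (\<zeta> ^ k * z)) / of_nat n" for z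
  \<comment> \<open>The coefficients of \<open>P\<close>: the mean of powers is 1 if
    \<open>n\<close> divides \<open>m\<close> and 0 otherwise.\<close>
  define c where "c m = p m * ((\<Sum>k<n. (\<zeta> ^ m) ^ k) / of_nat n)" for m
  have P_gauge: "F_gauge \<alpha> (P z) < 1" if "norm z < 1" for z
    using gauge_mean_less_one[OF \<alpha>, of "{..<n}" "\<lambda>k. g (\<zeta> ^ k * z)"] n that gauge
    by (auto simp: P_def norm_mult norm_power nz lessThan_empty_iff)
  have P_sums: "(\<lambda>m. c m * z ^ m) sums P z" if "norm z < 1" for z
  proof -
    have "(\<lambda>m. (\<Sum>k<n. p m * (\<zeta> ^ k * z) ^ m) / of_nat n) sums P z"
      unfolding P_def using that
      by (intro sums_divide sums_sum sums) (simp add: norm_mult norm_power nz)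
    also have "(\<lambda>m. (\<Sum>k<n. p m * (\<zeta> ^ k * z) ^ m) / of_nat n) = (\<lambda>m. c m * z ^ m)"
      by (simp add: c_def sum_distrib_left sum_distrib_right power_mult_distrib
          mult_ac sum_divide_distrib flip: power_mult)
    finally show ?thesis .
  qed
  \<comment> \<open>Averaging does not remove the index 0, since \<open>n\<close> divides it;
    \<open>p0\<close> does.\<close>
  have c_low: "c m = 0" if "m < n" for m
  proof (cases "m = 0")
    case False
    have "\<zeta> ^ m \<noteq> 1" "(\<zeta> ^ m) ^ n = 1"
      using False that by (auto simp: \<zeta>_eq_1 dest: dvd_imp_le simp flip: power_mult)
    thus ?thesis by (simp add: c_def geometric_sum)
  qed (simp add: c_def p0)
  have c_n: "c n = p n"
    using n \<zeta>_eq_1[of n] by (simp add: c_def)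
  define q where "q z = (\<Sum>m. c (m + n) * z ^ m)" for z
  have P_shift: "(\<lambda>m. c (m + n) * z ^ m * z ^ n) sums P z" if "norm z < 1" for z
    using sums_split_initial_segment[OF P_sums[OF that], of n] c_low
    by (simp add: power_add mult_ac)
  have q_sums: "(\<lambda>m. c (m + n) * z ^ m) sums q z" if "norm z < 1" for z
  proof (cases "z = 0")
    case False
    hence "(\<lambda>m. c (m + n) * z ^ m) sums (P z / z ^ n)"
      using sums_divide[OF P_shift[OF that], of "z ^ n"] by simp
    thus ?thesis unfolding q_def by (rule summable_sums[OF sums_summable])
  next
    case True
    thus ?thesis unfolding q_def
      using summable_sums[OF sums_summable[OF powser_sums_zero[of "\<lambda>m. c (m + n)"]]] by simp
  qed
  have P_eq: "P z = z ^ n * q z" if "norm z < 1" for z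
    using sums_unique2[OF P_shift[OF that] sums_mult2[OF q_sums[OF that]]] by simp
  have q_hol: "q holomorphic_on ball 0 1"
    by (rule power_series_holomorphic[where a = "\<lambda>m. c (m + n)"]) (use q_sums in simp_all)
  \<comment> \<open>\<open>z ^ n * K z\<close> is the inverse of \<open>F \<alpha>\<close>, i.e. \<open>v \<mapsto> 2 * v / (1 + csqrt (1 + 4 * \<alpha> * v\<^sup>2))\<close>, at \<open>P z\<close>.\<close>
  define K where "K z = 2 * q z / (1 + csqrt (1 + 4 * of_real \<alpha> * (z ^ n * q z)\<^sup>2))" for z
  have "norm (K 0) \<le> 1"
  proof (rule norm_at_zero_le_one)
    have cut: "1 + 4 * of_real \<alpha> * (z ^ n * q z)\<^sup>2 \<notin> \<real>\<^sub>\<le>\<^sub>0" if "norm z < 1" for z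
      using gauge_less_one_avoids_branch_cut[OF \<alpha>(1) \<alpha>1 P_gauge[OF that]] P_eq[OF that] by simp
    have "1 + csqrt x \<noteq> 0" for x :: complex
    proof
      assume "1 + csqrt x = 0"
      hence "Re (csqrt x) = -1" by (simp add: complex_eq_iff)
      thus False using csqrt_principal[of x] by simp
    qed
    thus "K holomorphic_on ball 0 1"
      unfolding K_def using cut by (intro holomorphic_intros q_hol) auto
    show "norm (z ^ n * K z) \<le> 1" if "norm z < 1" for z
      using norm_F_inverse_less_one[OF \<alpha>(1) \<alpha>1 P_gauge[OF that]] P_eq[OF that]
      by (simp add: K_def mult_ac)
  qed
  moreover have "q 0 = p n"
    using powser_zero[of "\<lambda>m. c (m + n)"] by (simp add: q_def c_n)
  \<comment> \<open>As \<open>n > 0\<close>, the root at \<open>z = 0\<close> is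
    \<open>csqrt 1 = 1\<close>, and the denominator 2 cancels the factor 2.\<close>
  moreover have "K 0 = q 0" using n by (simp add: K_def power_0_left)
  ultimately show ?thesis by simp
qed

section \<open>Coefficients of \<open>f\<close> from those of its logarithmic derivative\<close>

text \<open>The terms \<open>i = 0\<close> and \<open>i = n\<close> vanish, and the remaining
  \<open>n - 1\<close> terms of norm at most 1 are balanced by the factor on the left. At
  \<open>n = 1\<close> the recursion reads \<open>0 = 0\<close>, hence the separate
  \<open>a1\<close>.\<close>

lemma coeff_le_one_of_recursion:
  fixes a p :: "nat \<Rightarrow> complex"
  assumes a0: "a 0 = 0" and a1: "a 1 = 1" and p0: "p 0 = 0"
    and p: "\<And>n. n > 0 \<Longrightarrow> norm (p n) \<le> 1"
    and rec: "\<And>n. (of_nat n - 1) * a n = (\<Sum>i=0..n. p i * a (n - i))"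
  shows "norm (a n) \<le> 1"
proof (induction n rule: less_induct)
  case (less n)
  consider "n = 0" | "n = 1" | "n \<ge> 2" by linarith
  thus ?case
  proof cases
    case 3
    have "(of_nat n - 1) * a n = (\<Sum>i=1..<n. p i * a (n - i))"
      unfolding rec by (rule sum.mono_neutral_right) (auto simp: p0 a0 not_le less_Suc_eq)
    hence "norm ((of_nat n - 1) * a n) \<le> (\<Sum>i=1..<n. 1)"
      by (simp only:) (rule sum_norm_le,
        use less p in \<open>auto simp: norm_mult intro!: mult_le_one\<close>)
    moreover have "norm ((of_nat n - 1) * a n) = (real n - 1) * norm (a n)"
    proof -
      have "norm (of_nat n - 1 :: complex) = norm (of_real (real n - 1) :: complex)" by simp
      also have "\<dots> = real n - 1" using 3 by (simp only: norm_of_real)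
      finally show ?thesis by (simp only: norm_mult)
    qed
    ultimately have "(real n - 1) * norm (a n) \<le> (real n - 1) * 1" using 3 by (simp add: of_nat_diff)
    thus ?thesis using 3 by (subst (asm) mult_le_cancel_left_pos) auto
  qed (use a0 a1 in auto)
qed

theorem theorem2p2:
  fixes \<alpha> :: real and f :: "complex \<Rightarrow> complex" and a :: "nat \<Rightarrow> complex"
  assumes "0 \<le> \<alpha>" and "\<alpha> \<le> 3 - 2 * sqrt 2"
    and "f \<in> BS \<alpha>"
    and "normalized_expansion f a"
  shows "norm (a 2) \<le> 1 \<and>
    (\<forall>n\<ge>3. norm (a n) \<le> 1 / (real n - 1) * (\<Prod>k=2..n-1. real k / (real k - 1)))"
proof -
  have \<alpha>1: "\<alpha> < 1" using alpha_bounds[OF assms(1,2)] by simp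
  \<comment> \<open>\<open>a 0\<close> and \<open>a 1\<close> are unconstrained.\<close>
  define b where "b n = (if n = 0 then 0 else if n = 1 then 1 else a n)" for n
  have f_sums: "(\<lambda>n. b n * z ^ n) sums f z" if "norm z < 1" for z
  proof -
    have "(\<lambda>n. b (n + 2) * z ^ (n + 2)) sums (f z - z)"
      using assms(4) that by (simp add: normalized_expansion_def b_def)
    thus ?thesis
      unfolding sums_iff_shift[of "\<lambda>n. b n * z ^ n" 2] by (simp add: b_def numeral_2_eq_2)
  qed
  define g where "g z = zderiv_quotient f z - 1" for z
  obtain w where w: "w ` unit_disc \<subseteq> unit_disc" "\<And>z. norm z < 1 \<Longrightarrow> g z = F \<alpha> (w z)"
    and g_an: "g analytic_on unit_disc"
    and fnz: "\<And>z. norm z < 1 \<Longrightarrow> z \<noteq> 0 \<Longrightarrow> f z \<noteq> 0"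
    using assms(3) unfolding BS_def subordinate_def g_def[abs_def] by auto
  have g_hol: "g holomorphic_on ball 0 1"
    using g_an by (rule analytic_imp_holomorphic)
  define p where "p n = (deriv ^^ n) g 0 / fact n" for n
  have g_sums: "(\<lambda>n. p n * z ^ n) sums g z" if "norm z < 1" for z
    using holomorphic_power_series[OF g_hol, of z] that by (simp add: p_def)
  have gauge_g: "F_gauge \<alpha> (g z) < 1" if "norm z < 1" for z
  proof -
    have wz: "norm (w z) < 1" using w(1) that by (auto simp: image_subset_iff)
    hence "\<alpha> * (norm (w z))\<^sup>2 \<le> \<alpha> * 1"
      using assms(1) by (intro mult_left_mono) (auto simp: power_le_one)
    hence "\<alpha> * (norm (w z))\<^sup>2 < 1" using \<alpha>1 by simp
    thus ?thesis using gauge_F_less_one_iff[OF assms(1) \<alpha>1] wz w(2)[OF that] by simp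
  qed
  \<comment> \<open>This is the value 1 filled in at the origin.\<close>
  have p0: "p 0 = 0" by (simp add: p_def g_def zderiv_quotient_def)
  have p_le: "norm (p n) \<le> 1" if "n > 0" for n
    by (rule rogosinski_coeff_bound[OF assms(1,2) g_sums gauge_g p0 that])
  have f_fps: "f has_fps_expansion Abs_fps b"
    by (rule has_fps_expansionI) (use f_sums in \<open>auto intro!: eventually_mono[OF eventually_nhds_in_open[of "ball 0 1"]]\<close>)
  have g_fps: "g has_fps_expansion Abs_fps p"
    by (rule has_fps_expansionI) (use g_sums in \<open>auto intro!: eventually_mono[OF eventually_nhds_in_open[of "ball 0 1"]]\<close>)
  \<comment> \<open>Multiplying by \<open>f\<close> clears the quotient; at the origin both sides
    vanish because \<open>f 0 = 0\<close>.\<close>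
  have ev: "\<forall>\<^sub>F z in nhds 0. z * deriv f z - f z = g z * f z"
  proof (rule eventually_mono[OF eventually_nhds_in_open[of "ball 0 1"]])
    fix z :: complex assume "z \<in> ball 0 1"
    moreover have "f 0 = 0" using f_sums[of 0] by (simp add: b_def sums_iff)
    ultimately show "z * deriv f z - f z = g z * f z"
      using fnz[of z] by (cases "z = 0") (auto simp: g_def zderiv_quotient_def field_simps)
  qed auto
  have "(\<lambda>z. z * deriv f z - f z) has_fps_expansion fps_X * fps_deriv (Abs_fps b) - Abs_fps b"
    by (intro fps_expansion_intros f_fps)
  moreover have "(\<lambda>z. g z * f z) has_fps_expansion Abs_fps p * Abs_fps b"
    by (intro fps_expansion_intros f_fps g_fps)
  ultimately have fps_eq: "fps_X * fps_deriv (Abs_fps b) - Abs_fps b = Abs_fps p * Abs_fps b"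
    using has_fps_expansion_cong[OF ev refl] fps_expansion_unique_complex by blast
  have "(of_nat n - 1) * b n = (\<Sum>i=0..n. p i * b (n - i))" for n
  proof -
    have "(\<Sum>i=0..n. p i * b (n - i)) = fps_nth (fps_X * fps_deriv (Abs_fps b) - Abs_fps b) n"
      by (simp add: fps_eq fps_mult_nth)
    also have "\<dots> = (of_nat n - 1) * b n" by (cases n) (auto simp: algebra_simps)
    finally show ?thesis by simp
  qed
  hence b_le: "norm (b n) \<le> 1" for n
    by (intro coeff_le_one_of_recursion[of b p, OF _ _ p0 p_le]) (auto simp: b_def)
  have prod: "(\<Prod>k=2..n-1. real k / (real k - 1)) = real n - 1" if "n \<ge> 2" for n
    using that
  proof (induction n rule: dec_induct)
    case (step n)
    hence "{2..Suc n - 1} = insert n {2..n-1}" by auto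
    thus ?case using step by simp
  qed auto
  show ?thesis
  proof (intro conjI allI impI)
    show "norm (a 2) \<le> 1" using b_le[of 2] by (simp add: b_def)
    show "norm (a n) \<le> 1 / (real n - 1) * (\<Prod>k=2..n-1. real k / (real k - 1))" if "n \<ge> 3" for n
      using b_le[of n] that prod[of n] by (simp add: b_def)
  qed
qed

end
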